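(* Let $d>1$ be a square-free integer, let $K=\mathbb{Q}(\sqrt{-d})$ with ring of integers $\mathfrak{o}_K$, and let $\epsilon=x+y\sqrt{d}$ be the fundamental unit of $\mathbb{Q}(\sqrt{d})$. Let $u=x+(y\sqrt{-d})i$ and let $$w\in\Big\{\,y\sqrt{-d}+xk,\ \ \tfrac{x+1}{2}-\tfrac{y\sqrt{-d}}{2}i+\tfrac{x-1}{2}j+\tfrac{y\sqrt{-d}}{2}k,\ \ x^2-(xy\sqrt{-d})i-(y^2d)j+(xy\sqrt{-d})k\,\Big\}.$$ Then $\langle u,w\rangle\subset\mathcal{U}\!\left(\left(\frac{-1,-1}{\mathfrak{o}_K}\right)\right)$ is a free semigroup.
   Context: $\left(\frac{-1,-1}{K}\right)=K[i,j: i^2=-1,\ j^2=-1,\ -ji=ij=:k]$ is the quaternion algebra over $K$, and $\left(\frac{-1,-1}{\mathfrak{o}_K}\right)$ is the $\mathfrak{o}_K$-span of $\{1,i,j,k\}$, a subring; $\mathcal{U}(R)$ denotes the group of units of a ring $R$. The fundamental unit of $\mathbb{Q}(\sqrt d)$ (called the "fundamental invertible") is the fundamental unit $\epsilon=x+y\sqrt d>1$ of its ring of integers, with $x,y>0$; no condition is imposed on its norm $x^2-dy^2$, which is $1$ or $-1$. Here $\langle u,w\rangle$ denotes the semigroup generated by $u$ and $w$.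
   Formalization: It is additionally assumed that w has all its coordinates in the ring of integers of K; otherwise the claimed inclusion in the unit group is false, e.g. for d=3, where the fundamental unit is 2+√3 and the second w has constant term 3/2. *)

theory Defs
  imports Complex_Main "HOL-Computational_Algebra.Computational_Algebra"
begin

text \<open>
  For \<open>s\<close> a square root of a rational number, \<open>quad_field s\<close> is the field \<open>\<rat>(s)\<close>, realised inside
  the ambient field (below: inside the reals for \<open>\<rat>(\<surd>d)\<close>, inside the complex numbers for
  \<open>\<rat>(\<surd>-d)\<close>).
\<close>

definition quad_field :: "'a::field_char_0 \<Rightarrow> 'a set" where
  "quad_field s = {of_rat a + of_rat b * s | a b. True}"

definition ring_of_integers :: "'a::field_char_0 set \<Rightarrow> 'a set" where
  "ring_of_integers F = {z \<in> F. algebraic_int z}"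

definition units_in :: "'a::monoid_mult set \<Rightarrow> 'a set" where
  "units_in R = {a \<in> R. \<exists>b\<in>R. a * b = 1 \<and> b * a = 1}"

definition fundamental_unit :: "real set \<Rightarrow> real \<Rightarrow> bool" where
  "fundamental_unit R e \<longleftrightarrow> e \<in> units_in R \<and> e > 1 \<and>
     (\<forall>v \<in> units_in R. \<exists>n::int. v = e powi n \<or> v = - (e powi n))"

text \<open>\<open>Quat a b c e\<close> stands for \<open>a + b i + c j + e k\<close>, with \<open>i\<^sup>2 = j\<^sup>2 = -1\<close> and \<open>ij = k = -ji\<close>.\<close>

datatype 'a quat = Quat (quat1: 'a) (quati: 'a) (quatj: 'a) (quatk: 'a)

instantiation quat :: (comm_ring_1) ring_1
begin

definition "0 = Quat 0 0 0 0"
definition "1 = Quat 1 0 0 0"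
definition "p + q = Quat (quat1 p + quat1 q) (quati p + quati q) (quatj p + quatj q) (quatk p + quatk q)"
definition "- p = Quat (- quat1 p) (- quati p) (- quatj p) (- quatk p)"
definition "p - q = Quat (quat1 p - quat1 q) (quati p - quati q) (quatj p - quatj q) (quatk p - quatk q)"
definition "p * q = Quat
  (quat1 p * quat1 q - quati p * quati q - quatj p * quatj q - quatk p * quatk q)
  (quat1 p * quati q + quati p * quat1 q + quatj p * quatk q - quatk p * quatj q)
  (quat1 p * quatj q - quati p * quatk q + quatj p * quat1 q + quatk p * quati q)
  (quat1 p * quatk q + quati p * quatj q - quatj p * quati q + quatk p * quat1 q)"

instance
  by standard
    (auto simp: zero_quat_def one_quat_def plus_quat_def uminus_quat_def minus_quat_def
       times_quat_def algebra_simps intro: quat.expand)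

end

lemmas quat_defs = zero_quat_def one_quat_def plus_quat_def uminus_quat_def minus_quat_def
  times_quat_def

definition qi :: "'a::comm_ring_1 quat" where "qi = Quat 0 1 0 0"
definition qj :: "'a::comm_ring_1 quat" where "qj = Quat 0 0 1 0"
definition qk :: "'a::comm_ring_1 quat" where "qk = Quat 0 0 0 1"

lemma quat_relations:
  "(qi :: 'a::comm_ring_1 quat) * qi = - 1" "(qj :: 'a quat) * qj = - 1"
  "(qi :: 'a quat) * qj = qk" "(qj :: 'a quat) * qi = - qk"
  by (simp_all add: qi_def qj_def qk_def quat_defs)

lemma quat_scalar_central: "Quat a 0 0 0 * q = q * Quat a 0 0 0"
  by (simp add: quat_defs algebra_simps)

lemma Quat_expand:
  "Quat a b c e = Quat a 0 0 0 + Quat b 0 0 0 * qi + Quat c 0 0 0 * qj + Quat e 0 0 0 * qk"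
  by (simp add: qi_def qj_def qk_def quat_defs)

text \<open>
  The \<open>S\<close>-span of \<open>1, i, j, k\<close>; for \<open>S\<close> the ring of integers of \<open>K\<close> this is the order
  \<open>(-1,-1 / \<oo>\<^sub>K)\<close>, sitting inside the quaternion algebra over the complex numbers.
\<close>

definition quat_over :: "'a::comm_ring_1 set \<Rightarrow> 'a quat set" where
  "quat_over S = {Quat a b c e | a b c e. a \<in> S \<and> b \<in> S \<and> c \<in> S \<and> e \<in> S}"

inductive_set semigroup_gen :: "'a::semigroup_mult set \<Rightarrow> 'a set" for B where
  gen: "b \<in> B \<Longrightarrow> b \<in> semigroup_gen B"
| mult: "a \<in> semigroup_gen B \<Longrightarrow> b \<in> semigroup_gen B \<Longrightarrow> a * b \<in> semigroup_gen B"

text \<open>Every element of \<open>T\<close> is the product of exactly one nonempty word over \<open>B\<close>.\<close>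

definition free_semigroup_on :: "'a::monoid_mult set \<Rightarrow> 'a set \<Rightarrow> bool" where
  "free_semigroup_on B T \<longleftrightarrow> bij_betw prod_list (lists B - {[]}) T"

end

theory Submission imports Defs begin

text \<open>
  Put \<open>s = y \<surd>d\<close>, so that \<open>t = \<i> s\<close>, and split the quaternion algebra over the complex numbers as
  two-by-two matrices. Then \<open>u\<close> and \<open>w\<close> become scalar multiples of real matrices, \<open>u\<close> being
  \<open>diag(x + s, x - s)\<close>, and freeness follows from ping-pong for their Moebius action on the real
  line, with intervals depending on the shape of \<open>w\<close> and on the norm \<open>x\<^sup>2 - s\<^sup>2 = \<plusminus> 1\<close>. Membership
  of \<open>w\<close> in the order forces \<open>x\<close> and \<open>s\<^sup>2\<close> to be integers, and rules out norm \<open>-1\<close> for the second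
  shape, whose quaternion norm would be \<open>0\<close>. All coordinates of \<open>u\<close> and \<open>w\<close> lie in a ring
  \<open>\<int> + \<int> \<tau>\<close> with \<open>\<tau>\<^sup>2\<close> an integer, so the general theorem that algebraic integers form a ring
  is not needed.
\<close>

section \<open>Ping-pong for semigroups\<close>

text \<open>This is the surjectivity half of \<open>free_semigroup_on\<close>; ping-pong then only
  has to supply injectivity.\<close>

lemma prod_list_words:
  "prod_list ` (lists B - {[]}) = semigroup_gen (B :: 'a::monoid_mult set)"
proof (intro equalityI subsetI)
  fix a assume "a \<in> prod_list ` (lists B - {[]})"
  then obtain ps where "ps \<in> lists B" "ps \<noteq> []" "a = prod_list ps" by auto
  then show "a \<in> semigroup_gen B"
  proof (induction ps arbitrary: a)
    case (Cons p ps)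
    then show ?case
      by (cases "ps = []") (auto intro: semigroup_gen.intros)
  qed simp
next
  fix a assume "a \<in> semigroup_gen B"
  then show "a \<in> prod_list ` (lists B - {[]})"
  proof induction
    case (gen b)
    then show ?case by (intro image_eqI[of _ _ "[b]"]) auto
  next
    case (mult a b)
    then obtain ps qs where
      "ps \<in> lists B - {[]}" "qs \<in> lists B - {[]}" "a = prod_list ps" "b = prod_list qs" by auto
    then show ?case by (intro image_eqI[of _ _ "ps @ qs"]) auto
  qed
qed

text \<open>The first letter of a nonempty word decides whether \<open>v0\<close> lands in
  \<open>U\<close> or in \<open>W\<close>, so words with equal products start alike. A left inverse
  cancels the common letter, and induction finishes.\<close>

lemma ping_pong:
  fixes u w :: "'a::monoid_mult" and act :: "'a \<Rightarrow> 'b \<Rightarrow> 'b"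
  assumes act_one: "\<And>v. act 1 v = v"
    and act_mult: "\<And>a b v. act (a * b) v = act a (act b v)"
    and inv: "u' * u = 1" "w' * w = 1"
    and disj: "U \<inter> W = {}" and v0: "v0 \<in> U \<union> W"
    and U: "\<And>v. v \<in> U \<union> W \<Longrightarrow> act u v \<in> U"
    and W: "\<And>v. v \<in> U \<union> W \<Longrightarrow> act w v \<in> W"
  shows "u \<noteq> w" and "free_semigroup_on {u, w} (semigroup_gen {u, w})"
proof -
  show neq: "u \<noteq> w" using U[OF v0] W[OF v0] disj by auto
  have stable: "act (prod_list ps) v \<in> U \<union> W" if "ps \<in> lists {u, w}" "v \<in> U \<union> W" for ps v
    using that by (induction ps) (use U W in \<open>auto simp: act_one act_mult\<close>)
  have head_u: "act (u * prod_list ps) v \<in> U" if "ps \<in> lists {u, w}" "v \<in> U \<union> W" for ps v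
    unfolding act_mult by (intro U stable that)
  have head_w: "act (w * prod_list ps) v \<in> W" if "ps \<in> lists {u, w}" "v \<in> U \<union> W" for ps v
    unfolding act_mult by (intro W stable that)
  \<comment> \<open>The empty word has no first letter to compare, so it is treated apart: a product
    equal to 1 would fix \<open>act w v0\<close> or \<open>act u v0\<close>, yet its first letter
    moves that point into the other set.\<close>
  have nontrivial: "prod_list (q # qs) \<noteq> 1" if q: "q \<in> {u, w}" "qs \<in> lists {u, w}" for q qs
  proof
    assume eq: "prod_list (q # qs) = 1"
    show False
    proof (cases "q = u")
      case True
      with head_u[OF q(2), of "act w v0"] W[OF v0] eq act_one disj show False by auto
    next
      case False
      with head_w[OF q(2), of "act u v0"] U[OF v0] eq act_one disj q show False by auto
    qed
  qed
  have "ps = qs" if "ps \<in> lists {u, w}" "qs \<in> lists {u, w}" "prod_list ps = prod_list qs" for ps qs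
    using that
  proof (induction ps arbitrary: qs rule: list.induct)
    case Nil
    show ?case
    proof (cases qs)
      case (Cons q qs')
      with Nil nontrivial[of q qs'] show ?thesis by auto
    qed simp
  next
    case (Cons p ps)
    show ?case
    proof (cases qs)
      case Nil
      have "p \<in> {u, w}" "ps \<in> lists {u, w}" using Cons.prems(1) by auto
      from nontrivial[OF this] Nil Cons.prems(3) show ?thesis by simp
    next
      case (Cons q qs')
      note pq = Cons
      have mem: "p \<in> {u, w}" "q \<in> {u, w}" "ps \<in> lists {u, w}" "qs' \<in> lists {u, w}"
        using Cons.prems pq by auto
      have eq: "p * prod_list ps = q * prod_list qs'" using Cons.prems pq by simp
      have "p = q"
        using mem(1,2) head_u[OF mem(3) v0] head_w[OF mem(3) v0]
          head_u[OF mem(4) v0] head_w[OF mem(4) v0] eq disj by auto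
      moreover obtain p' where "p' * p = 1" using mem(1) inv by auto
      ultimately have "prod_list ps = prod_list qs'"
        using eq by (metis mult.assoc mult_1_left)
      with Cons.IH mem \<open>p = q\<close> pq show ?thesis by auto
    qed
  qed
  then have "inj_on prod_list (lists {u, w} - {[]})" by (auto intro!: inj_onI)
  then show "free_semigroup_on {u, w} (semigroup_gen {u, w})"
    unfolding free_semigroup_on_def bij_betw_def using prod_list_words by auto
qed

section \<open>Complex quaternions as Moebius transformations\<close>

text \<open>The two signs give two representations by two-by-two matrices, conjugate under
  \<open>diag(1, -1)\<close>. Having both allows all the intervals below to be chosen around positive reals
  whenever the matrix of \<open>u\<close> has positive determinant.\<close>

definition quat_act :: "complex \<Rightarrow> complex quat \<Rightarrow> complex \<times> complex \<Rightarrow> complex \<times> complex" where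
  "quat_act \<sigma> q v =
     ((quat1 q - \<i> * quati q) * fst v + \<sigma> * (\<i> * quatk q - quatj q) * snd v,
      \<sigma> * (\<i> * quatk q + quatj q) * fst v + (quat1 q + \<i> * quati q) * snd v)"

lemma quat_act_one: "quat_act \<sigma> 1 v = v"
  by (simp add: quat_act_def one_quat_def)

lemma quat_act_mult:
  assumes "\<sigma> * \<sigma> = 1"
  shows "quat_act \<sigma> (p * q) v = quat_act \<sigma> p (quat_act \<sigma> q v)"
proof -
  have i: "\<i> * (\<i> * z) = - z" for z by (simp flip: mult.assoc)
  have s: "\<sigma> * (\<sigma> * z) = z" for z by (simp add: assms flip: mult.assoc)
  have s': "\<sigma> * (z * (\<sigma> * z')) = z * z'" for z z'
    by (metis s mult.left_commute)
  show ?thesis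
    unfolding quat_act_def times_quat_def
    by (simp add: prod_eq_iff algebra_simps i s s')
qed

text \<open>The matrix of \<open>q\<close> is real only up to a complex factor: for
  \<open>w = t + r k\<close> that factor is the imaginary unit. The factor does not affect the
  Moebius map.\<close>

definition acts_as :: "complex \<Rightarrow> complex quat \<Rightarrow> real \<Rightarrow> real \<Rightarrow> real \<Rightarrow> real \<Rightarrow> bool" where
  "acts_as \<sigma> q a b c e \<longleftrightarrow> (\<exists>\<kappa>. \<kappa> \<noteq> 0 \<and>
     quat1 q - \<i> * quati q = \<kappa> * of_real a \<and> \<sigma> * (\<i> * quatk q - quatj q) = \<kappa> * of_real b \<and>
     \<sigma> * (\<i> * quatk q + quatj q) = \<kappa> * of_real c \<and> quat1 q + \<i> * quati q = \<kappa> * of_real e)"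

text \<open>Points of the projective line with a finite real coordinate. Infinity is left out, so
  every use has to show that a denominator is nonzero.\<close>

definition lines :: "real set \<Rightarrow> (complex \<times> complex) set" where
  "lines Z = {(of_real z * m, m) | z m. z \<in> Z \<and> m \<noteq> 0}"

lemma acts_as_lines:
  assumes q: "acts_as \<sigma> q a b c e" and v: "v \<in> lines Z"
    and Z: "\<And>z. z \<in> Z \<Longrightarrow> c * z + e \<noteq> 0 \<and> (a * z + b) / (c * z + e) \<in> Z'"
  shows "quat_act \<sigma> q v \<in> lines Z'"
proof -
  from v obtain z m where zm: "v = (of_real z * m, m)" "z \<in> Z" "m \<noteq> 0" by (auto simp: lines_def)
  from q obtain \<kappa> where k: "\<kappa> \<noteq> 0" "quat1 q - \<i> * quati q = \<kappa> * of_real a"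
    "\<sigma> * (\<i> * quatk q - quatj q) = \<kappa> * of_real b"
    "\<sigma> * (\<i> * quatk q + quatj q) = \<kappa> * of_real c" "quat1 q + \<i> * quati q = \<kappa> * of_real e"
    unfolding acts_as_def by blast
  define n D where "n = a * z + b" and "D = c * z + e"
  have nz: "D \<noteq> 0" and mem: "n / D \<in> Z'" using Z zm(2) unfolding n_def D_def by blast+
  have "quat_act \<sigma> q v = (\<kappa> * of_real n * m, \<kappa> * of_real D * m)"
    unfolding quat_act_def zm k fst_conv snd_conv by (simp add: n_def D_def algebra_simps)
  also have "\<dots> = (of_real (n / D) * (\<kappa> * of_real D * m), \<kappa> * of_real D * m)"
    using nz by simp
  finally have "quat_act \<sigma> q v = (of_real (n / D) * (\<kappa> * of_real D * m), \<kappa> * of_real D * m)" .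
  moreover have "\<kappa> * of_real D * m \<noteq> 0" using nz k(1) zm(3) by simp
  moreover note mem
  ultimately show ?thesis unfolding lines_def by blast
qed

lemma mobius_ping_pong:
  assumes \<sigma>: "\<sigma> * \<sigma> = 1" and inv: "u' * u = 1" "w' * w = 1"
    and u: "acts_as \<sigma> u a b c e" and w: "acts_as \<sigma> w a' b' c' e'"
    and disj: "U \<inter> W = {}" and z0: "z0 \<in> U \<union> W"
    and U: "\<And>z. z \<in> U \<union> W \<Longrightarrow> c * z + e \<noteq> 0 \<and> (a * z + b) / (c * z + e) \<in> U"
    and W: "\<And>z. z \<in> U \<union> W \<Longrightarrow> c' * z + e' \<noteq> 0 \<and> (a' * z + b') / (c' * z + e') \<in> W"
  shows "u \<noteq> w \<and> free_semigroup_on {u, w} (semigroup_gen {u, w})"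
proof -
  have union: "lines U \<union> lines W = lines (U \<union> W)" by (auto simp: lines_def)
  have "lines U \<inter> lines W = {}" using disj by (fastforce simp: lines_def)
  moreover have "(of_real z0, 1) \<in> lines U \<union> lines W"
    using z0 unfolding union lines_def by force
  ultimately show ?thesis
    using ping_pong[where act = "quat_act \<sigma>" and u = u and w = w and U = "lines U" and W = "lines W"]
      acts_as_lines[OF u _ U] acts_as_lines[OF w _ W] quat_act_one quat_act_mult[OF \<sigma>] inv
    unfolding union by blast
qed

section \<open>Norm 1: ping-pong on a positive half-line\<close>

text \<open>Here \<open>u\<close> multiplies by \<open>E = (x + s)^2 > 1\<close> and so moves
  everything beyond \<open>a\<close> past \<open>E * a\<close>. It remains for \<open>w\<close> to
  map that half-line between \<open>a\<close> and \<open>E * a\<close>, which is what the last three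
  hypotheses say with denominators cleared.\<close>

lemma mobius_ping_pong_pos:
  assumes \<sigma>: "\<sigma> * \<sigma> = 1" and inv: "u' * u = 1" "w' * w = 1"
    and norm: "x\<^sup>2 - s\<^sup>2 = 1" and pos: "0 < x" "0 < s" "0 < (a::real)"
    and u: "acts_as \<sigma> u (x + s) 0 0 (x - s)" and w: "acts_as \<sigma> w a' b' c' e'"
    and den: "\<And>z. z > a \<Longrightarrow> 0 < c' * z + e'"
    and lower: "\<And>z. z > a \<Longrightarrow> a * (c' * z + e') < a' * z + b'"
    and upper: "\<And>z. z > a \<Longrightarrow> a' * z + b' < (x + s)\<^sup>2 * a * (c' * z + e')"
  shows "u \<noteq> w \<and> free_semigroup_on {u, w} (semigroup_gen {u, w})"
proof -
  define E where "E = (x + s)\<^sup>2"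
  have one: "(x + s) * (x - s) = 1" using norm by (simp add: power2_eq_square algebra_simps)
  then have nz: "x - s \<noteq> 0" by auto
  have uz: "(x + s) * z / (x - s) = E * z" for z
    using nz one by (simp add: E_def divide_eq_eq power2_eq_square)
  have "E = 1 + 2 * s\<^sup>2 + 2 * x * s" using norm by (simp add: E_def power2_eq_square algebra_simps)
  then have E: "E > 1" using pos by (simp add: add_pos_pos)
  then have "E * a > a" using pos by simp
  show ?thesis
  proof (rule mobius_ping_pong[OF \<sigma> inv u w, of "{z. E * a < z}" "{z. a < z \<and> z < E * a}" "E * a + 1"])
    fix z assume "z \<in> {z. E * a < z} \<union> {z. a < z \<and> z < E * a}"
    then have z: "a < z" using \<open>E * a > a\<close> by auto
    show "0 * z + (x - s) \<noteq> 0 \<and> ((x + s) * z + 0) / (0 * z + (x - s)) \<in> {z. E * a < z}"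
      using nz z E by (simp add: uz)
    show "c' * z + e' \<noteq> 0 \<and> (a' * z + b') / (c' * z + e') \<in> {z. a < z \<and> z < E * a}"
      using den[OF z] lower[OF z] upper[OF z]
      by (simp add: pos_less_divide_eq pos_divide_less_eq E_def)
  qed auto
qed

text \<open>The real matrix of \<open>w\<close> has determinant \<open>s^2 - x^2 = -1\<close>, so
  its map decreases on the positive axis. The endpoint \<open>s / x\<close> is its limit at infinity
  and hence a lower bound for its values.\<close>

lemma swap_shape_free_pos:
  assumes t: "t = \<i> * of_real s" and r: "r = of_real x"
    and norm: "x\<^sup>2 - s\<^sup>2 = 1" and x: "x \<ge> 2" and s: "s > 0"
    and u: "u = Quat r t 0 0" and w: "w = Quat t 0 0 r"
    and inv: "u' * u = 1" "w' * w = 1"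
  shows "u \<noteq> w \<and> free_semigroup_on {u, w} (semigroup_gen {u, w})"
proof (rule mobius_ping_pong_pos[where \<sigma> = 1 and x = x and s = s and a = "s / x"
      and a' = s and b' = x and c' = x and e' = s, OF _ inv norm])
  have s2: "s\<^sup>2 \<ge> 3" using norm power_mono[OF x, of 2] by simp
  show "acts_as 1 u (x + s) 0 0 (x - s)"
    unfolding acts_as_def u r t by (intro exI[of _ 1]) (simp add: algebra_simps)
  show "acts_as 1 w s x x s"
    unfolding acts_as_def w r t by (intro exI[of _ \<i>]) (simp add: algebra_simps)
  fix z assume z: "s / x < z"
  then have z0: "z > 0" using x s by (smt (verit) divide_pos_pos)
  show "0 < x * z + s" using z0 x s by (simp add: add_pos_pos)
  show "s / x * (x * z + s) < s * z + x"
    using x norm by (simp add: field_simps power2_eq_square)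
  \<comment> \<open>The upper bound is proved by comparing the coefficients of \<open>z\<close> and
    the constant terms separately.\<close>
  have "(x + s)\<^sup>2 \<ge> x\<^sup>2 + s\<^sup>2" using x s by (simp add: power2_eq_square algebra_simps)
  then have E: "(x + s)\<^sup>2 > 1" "(x + s)\<^sup>2 > x\<^sup>2" using s2 norm by simp_all
  have "x\<^sup>2 < (x + s)\<^sup>2 * s\<^sup>2"
    using mult_mono[of 1 "s\<^sup>2" "(x + s)\<^sup>2" "(x + s)\<^sup>2"] E s2 by (simp add: mult.commute)
  then have "x < (x + s)\<^sup>2 * (s\<^sup>2 / x)"
    using x by (simp add: pos_less_divide_eq power2_eq_square)
  moreover have "s * z < (x + s)\<^sup>2 * (s * z)" using E s z0 by simp
  moreover have "(x + s)\<^sup>2 * (s / x) * (x * z + s) = (x + s)\<^sup>2 * (s * z) + (x + s)\<^sup>2 * (s\<^sup>2 / x)"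
    using x by (simp add: field_simps power2_eq_square)
  ultimately show "s * z + x < (x + s)\<^sup>2 * (s / x) * (x * z + s)" by linarith
qed (use x s in auto)

text \<open>The matrix of \<open>2 w\<close> has determinant 4, so the map increases on the positive
  axis; the endpoint is its value at 0. The upper bound reflects its limit at infinity,
  \<open>(x + 1 - s) / (s - x + 1)\<close>.\<close>

lemma half_shape_free_pos:
  assumes t: "t = \<i> * of_real s" and r: "r = of_real x"
    and norm: "x\<^sup>2 - s\<^sup>2 = 1" and x: "x \<ge> 2" and s: "s > 0"
    and u: "u = Quat r t 0 0" and w: "w = Quat ((r + 1) / 2) (- t / 2) ((r - 1) / 2) (t / 2)"
    and inv: "u' * u = 1" "w' * w = 1"
  shows "u \<noteq> w \<and> free_semigroup_on {u, w} (semigroup_gen {u, w})"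
proof (rule mobius_ping_pong_pos[where \<sigma> = "-1" and x = x and s = s
      and a = "(x - 1 + s) / (x + 1 + s)"
      and a' = "x + 1 - s" and b' = "x - 1 + s" and c' = "s - x + 1" and e' = "x + 1 + s",
      OF _ inv norm])
  have s2: "s\<^sup>2 \<ge> 3" using norm power_mono[OF x, of 2] by simp
  show "acts_as (-1) u (x + s) 0 0 (x - s)"
    unfolding acts_as_def u r t by (intro exI[of _ 1]) (simp add: algebra_simps)
  show "acts_as (-1) w (x + 1 - s) (x - 1 + s) (s - x + 1) (x + 1 + s)"
    unfolding acts_as_def w r t by (intro exI[of _ "1/2"]) (simp add: field_simps)
  let ?a = "(x - 1 + s) / (x + 1 + s)"
  have a: "?a > 0" using x s by simp
  then show "0 < ?a" .
  \<comment> \<open>This makes \<open>c'\<close> positive and keeps the pole of the map off the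
    positive axis.\<close>
  have "x - 1 < s" by (rule power2_less_imp_less) (use x s norm in \<open>auto simp: power2_eq_square algebra_simps\<close>)
  then have c: "s - x + 1 > 0" by simp
  \<comment> \<open>Multiplied by \<open>x + 1 + s\<close>, the two coefficients of \<open>z\<close>
    become \<open>2 * x - 2\<close> and \<open>2 * x + 2\<close>. The upper bound thus needs
    \<open>2 * x + 2\<close> to be at most \<open>(x + s)^2 * (2 * x - 2)\<close>, which holds from
    \<open>x = 2\<close> on.\<close>
  have ac: "?a * (s - x + 1) * (x + 1 + s) = 2 * x - 2"
    using x s norm by (simp add: field_simps power2_eq_square)
  have pe: "(x + 1 - s) * (x + 1 + s) = 2 * x + 2"
    using norm by (simp add: field_simps power2_eq_square)
  fix z assume "?a < z"
  then have z0: "z > 0" using a by simp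
  show den: "0 < (s - x + 1) * z + (x + 1 + s)" using c z0 x s by (simp add: add_pos_pos)
  have split: "?a * ((s - x + 1) * z + (x + 1 + s)) = ?a * (s - x + 1) * z + (x - 1 + s)"
    using x s by (simp add: field_simps)
  have "?a * (s - x + 1) * (x + 1 + s) < (x + 1 - s) * (x + 1 + s)" unfolding ac pe by simp
  then have "?a * (s - x + 1) < x + 1 - s"
    by (rule mult_right_less_imp_less) (use x s in simp)
  from mult_strict_right_mono[OF this z0]
  show "?a * ((s - x + 1) * z + (x + 1 + s)) < (x + 1 - s) * z + (x - 1 + s)"
    unfolding split by linarith
  have "(x + s)\<^sup>2 \<ge> x\<^sup>2 + s\<^sup>2" using x s by (simp add: power2_eq_square algebra_simps)
  then have E: "(x + s)\<^sup>2 \<ge> 7" using s2 norm by simp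
  have "2 * x + 2 \<le> 7 * (2 * x - 2)" using x by simp
  also have "\<dots> \<le> (x + s)\<^sup>2 * (2 * x - 2)" using E x by (intro mult_right_mono) auto
  also have "\<dots> = (x + s)\<^sup>2 * (?a * (s - x + 1)) * (x + 1 + s)"
    by (simp only: mult.assoc flip: ac)
  finally have "(x + 1 - s) * (x + 1 + s) \<le> (x + s)\<^sup>2 * (?a * (s - x + 1)) * (x + 1 + s)"
    unfolding pe .
  then have "x + 1 - s \<le> (x + s)\<^sup>2 * (?a * (s - x + 1))"
    by (rule mult_right_le_imp_le) (use x s in simp)
  then have main: "(x + 1 - s) * z \<le> (x + s)\<^sup>2 * (?a * (s - x + 1)) * z"
    using z0 by (intro mult_right_mono) auto
  have "1 * (x - 1 + s) < (x + s)\<^sup>2 * (x - 1 + s)"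
    by (rule mult_strict_right_mono) (use E x s in linarith)+
  then have const: "x - 1 + s < (x + s)\<^sup>2 * (x - 1 + s)" by (simp only: mult_1_left)
  have "(x + s)\<^sup>2 * ?a * ((s - x + 1) * z + (x + 1 + s))
      = (x + s)\<^sup>2 * (?a * (s - x + 1)) * z + (x + s)\<^sup>2 * (x - 1 + s)"
    unfolding mult.assoc[of "(x + s)\<^sup>2" ?a] split
    by (simp only: distrib_left[of "(x + s)\<^sup>2" _ "x - 1 + s"] mult.assoc)
  then show "(x + 1 - s) * z + (x - 1 + s) < (x + s)\<^sup>2 * ?a * ((s - x + 1) * z + (x + 1 + s))"
    using add_le_less_mono[OF main const] by (simp only:)
qed (use x s in auto)

text \<open>Dividing the matrix of \<open>w\<close> by \<open>x - s = 1 / (x + s)\<close> shows that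
  \<open>w\<close> acts as \<open>(x * z + s) / (s * z + x)\<close> followed by division by
  \<open>E = (x + s)^2\<close>. This map increases on the positive axis; the endpoint is its value
  at 0, and its limit \<open>x / (s * E)\<close> at infinity lies below
  \<open>E * a = s / x\<close>.\<close>

lemma square_shape_free_pos:
  assumes t: "t = \<i> * of_real s" and r: "r = of_real x"
    and norm: "x\<^sup>2 - s\<^sup>2 = 1" and x: "x \<ge> 2" and s: "s > 0"
    and u: "u = Quat r t 0 0" and w: "w = Quat (r\<^sup>2) (- (r * t)) (t\<^sup>2) (r * t)"
    and inv: "u' * u = 1" "w' * w = 1"
  shows "u \<noteq> w \<and> free_semigroup_on {u, w} (semigroup_gen {u, w})"
proof (rule mobius_ping_pong_pos[where \<sigma> = "-1" and x = x and s = s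
      and a = "s / (x * (x + s)\<^sup>2)" and a' = x and b' = s
      and c' = "s * (x + s)\<^sup>2" and e' = "x * (x + s)\<^sup>2", OF _ inv norm])
  have s2: "s\<^sup>2 \<ge> 3" using norm power_mono[OF x, of 2] by simp
  define E where "E = (x + s)\<^sup>2"
  have "E \<ge> x\<^sup>2 + s\<^sup>2" using x s by (simp add: E_def power2_eq_square algebra_simps)
  then have E: "E > 1" "E > x\<^sup>2" using s2 norm by simp_all
  have one: "(x - s) * (x + s) = 1" using norm by (simp add: power2_eq_square algebra_simps)
  have k: "(x - s) * E = x + s" using one by (simp add: E_def power2_eq_square flip: mult.assoc)
  show "acts_as (-1) u (x + s) 0 0 (x - s)"
    unfolding acts_as_def u r t by (intro exI[of _ 1]) (simp add: algebra_simps)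
  have "acts_as (-1) w x s (s * E) (x * E)"
    unfolding acts_as_def w
  proof (intro exI[of _ "of_real (x - s)"] conjI)
    show "complex_of_real (x - s) \<noteq> 0" using one by (auto simp del: of_real_diff)
    have k1: "(x - s) * (s * E) = s * (x + s)" "(x - s) * (x * E) = x * (x + s)"
      using k by (metis mult.left_commute)+
    show "- 1 * (\<i> * quatk (Quat (r\<^sup>2) (- (r * t)) (t\<^sup>2) (r * t)) + quatj (Quat (r\<^sup>2) (- (r * t)) (t\<^sup>2) (r * t)))
      = of_real (x - s) * of_real (s * E)"
      unfolding of_real_mult[symmetric] k1 by (simp add: r t power2_eq_square algebra_simps)
    show "quat1 (Quat (r\<^sup>2) (- (r * t)) (t\<^sup>2) (r * t)) + \<i> * quati (Quat (r\<^sup>2) (- (r * t)) (t\<^sup>2) (r * t))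
      = of_real (x - s) * of_real (x * E)"
      unfolding of_real_mult[symmetric] k1 by (simp add: r t power2_eq_square algebra_simps)
  qed (simp_all add: r t power2_eq_square algebra_simps)
  then show "acts_as (-1) w x s (s * (x + s)\<^sup>2) (x * (x + s)\<^sup>2)" by (simp add: E_def)
  show "0 < s / (x * (x + s)\<^sup>2)" using x s E by (simp flip: E_def)
  fix z assume z: "s / (x * (x + s)\<^sup>2) < z"
  then have z0: "z > 0" using \<open>0 < s / (x * (x + s)\<^sup>2)\<close> by simp
  show "0 < s * (x + s)\<^sup>2 * z + x * (x + s)\<^sup>2"
    using z0 x s E by (auto simp flip: E_def intro!: add_pos_pos mult_pos_pos)
  have eq: "s / (x * E) * (s * E * z + x * E) = s\<^sup>2 / x * z + s"
    using x E by (simp add: field_simps power2_eq_square)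
  have "s\<^sup>2 / x < x" using x norm by (simp add: pos_divide_less_eq power2_eq_square)
  from mult_strict_right_mono[OF this z0]
  show "s / (x * (x + s)\<^sup>2) * (s * (x + s)\<^sup>2 * z + x * (x + s)\<^sup>2) < x * z + s"
    unfolding E_def[symmetric] eq by linarith
  have "E * 1 \<le> E * s\<^sup>2" using E s2 by (intro mult_left_mono) auto
  then have "x\<^sup>2 < E * s\<^sup>2" using E by linarith
  then have "x < E * (s\<^sup>2 / x)" using x by (simp add: pos_less_divide_eq power2_eq_square)
  from mult_strict_right_mono[OF this z0] have "x * z < E * (s\<^sup>2 / x) * z" .
  moreover have "s < E * s" using E s by simp
  moreover have "E * (s / (x * E)) * (s * E * z + x * E) = E * (s\<^sup>2 / x) * z + E * s"
    using eq by (metis distrib_left mult.assoc)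
  ultimately show "x * z + s < (x + s)\<^sup>2 * (s / (x * (x + s)\<^sup>2)) * (s * (x + s)\<^sup>2 * z + x * (x + s)\<^sup>2)"
    unfolding E_def[symmetric] by linarith
qed (use x s in auto)

section \<open>Norm -1: \<open>u\<close> reverses the sign of the real coordinate\<close>

text \<open>Now \<open>u\<close> acts as \<open>z -> - E * z\<close>, sending \<open>z > 1\<close>
  below \<open>- E\<close> and \<open>z < - E\<close> above \<open>E^2\<close>; this dictates
  \<open>U\<close>. The map of \<open>w\<close> increases on either side of its pole and fixes 1,
  which gives the left end of \<open>W\<close>.\<close>

lemma swap_shape_free_neg:
  assumes t: "t = \<i> * of_real s" and r: "r = of_real x"
    and norm: "s\<^sup>2 = x\<^sup>2 + 1" and x: "x \<ge> 1" and s: "s > 0"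
    and u: "u = Quat r t 0 0" and w: "w = Quat t 0 0 r"
    and inv: "u' * u = 1" "w' * w = 1"
  shows "u \<noteq> w \<and> free_semigroup_on {u, w} (semigroup_gen {u, w})"
proof -
  define E where "E = (x + s)\<^sup>2"
  define U W where "U = {z. z > E\<^sup>2 \<or> z < - E}" and "W = {z. 1 < z \<and> z < E\<^sup>2}"
  have one: "(x + s) * (x - s) = - 1" using norm by (simp add: power2_eq_square algebra_simps)
  then have nz: "x - s \<noteq> 0" by auto
  have xs: "x < s" by (rule power2_less_imp_less) (use norm s in auto)
  have "E = 2 * x\<^sup>2 + 1 + 2 * (x * s)" using norm by (simp add: E_def power2_eq_square algebra_simps)
  moreover have "x\<^sup>2 \<ge> 1" "x * s \<ge> s" using x s by (auto simp: one_le_power)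
  ultimately have E: "E \<ge> 3 + 2 * s" by linarith
  then have E1: "E > 1" using s by simp
  then have E2: "E\<^sup>2 > E" by (simp add: power2_eq_square)
  show ?thesis
  proof (rule mobius_ping_pong[where \<sigma> = 1 and a = "x + s" and b = 0 and c = 0 and e = "x - s"
        and a' = s and b' = x and c' = x and e' = s and U = U and W = W and ?z0.0 = "E\<^sup>2 + 1", OF _ inv])
    show "acts_as 1 u (x + s) 0 0 (x - s)"
      unfolding acts_as_def u r t by (intro exI[of _ 1]) (simp add: algebra_simps)
    show "acts_as 1 w s x x s"
      unfolding acts_as_def w r t by (intro exI[of _ \<i>]) (simp add: algebra_simps)
    fix z assume "z \<in> U \<union> W"
    then have z: "z < - E \<or> 1 < z" using E1 E2 unfolding U_def W_def by auto
    have "(x + s) * z = - (E * z) * (x - s)" using one unfolding E_def by algebra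
    then have uz: "(x + s) * z / (x - s) = - (E * z)" using nz by (simp add: divide_eq_eq)
    have "- (E * z) \<in> U"
      using z
    proof
      assume "z < - E"
      then have "E * E < E * - z" using E1 by (intro mult_strict_left_mono) auto
      then show ?thesis by (simp add: U_def power2_eq_square)
    qed (use E1 in \<open>simp add: U_def\<close>)
    then show "0 * z + (x - s) \<noteq> 0 \<and> ((x + s) * z + 0) / (0 * z + (x - s)) \<in> U"
      using nz by (simp add: uz)
    from z show "x * z + s \<noteq> 0 \<and> (s * z + x) / (x * z + s) \<in> W"
    proof
      assume z: "1 < z"
      then have den: "x * z + s > 0" using x s by (simp add: add_pos_pos)
      have "(s - x) * 1 < (s - x) * z" using z xs by simp
      then have "x * z + s < s * z + x" by (simp add: algebra_simps)
      moreover have "s * z + x < E\<^sup>2 * (x * z + s)"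
      proof -
        have "s * z + x < E * (x * z + s)"
        proof -
          have "s * z < E * (x * z)"
            using mult_mono[of s E 1 x] mult_strict_right_mono[of s "E * x" z] E x s z
            by (smt (verit) mult.assoc mult_left_le mult_le_cancel_left1)
          moreover have "x < E * s" using xs E1 s by (smt (verit) mult_le_cancel_right1)
          ultimately show ?thesis by (simp add: distrib_left)
        qed
        also have "\<dots> < E\<^sup>2 * (x * z + s)" using E2 den by simp
        finally show ?thesis .
      qed
      ultimately show ?thesis using den
        by (simp add: W_def pos_less_divide_eq pos_divide_less_eq)
    next
      assume "z < - E"
      then have m: "- z > E" by simp
      \<comment> \<open>So \<open>z\<close> lies left of the pole \<open>- s / x\<close>: the
        denominator is negative and both inequalities for the quotient flip.\<close>
      have xm: "x * - z > s" using mult_mono[of 1 x "- z" "- z"] x m E s by linarith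
      then have den: "x * z + s < 0" by simp
      have "(s - x) * - 1 > (s - x) * z" using m E1 xs by (intro mult_strict_left_mono) auto
      then have "s * z + x < x * z + s" using xs by (simp add: algebra_simps)
      moreover have "E\<^sup>2 * (x * z + s) < s * z + x"
      proof -
        \<comment> \<open>The claim is linear in \<open>- z\<close> with positive slope
          \<open>E^2 * x - s\<close>, so it is enough to check it at \<open>- z = E\<close>.\<close>
        have "E * x \<ge> E" using x E1 by simp
        then have e: "E * x \<ge> s + 1" using E s by linarith
        have "E * x - s \<ge> 1" using e by simp
        then have "E\<^sup>2 * 1 \<le> E\<^sup>2 * (E * x - s)" by (intro mult_left_mono) auto
        moreover have "E\<^sup>2 * x \<ge> E\<^sup>2" using x by (simp add: mult_le_cancel_left1)
        then have "E\<^sup>2 * x - s > 0" using E2 E s by linarith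
        then have "(E\<^sup>2 * x - s) * E < (E\<^sup>2 * x - s) * - z" using m by (intro mult_strict_left_mono)
        moreover have "s * E \<le> E * E" using E E1 s by (intro mult_right_mono) auto
        ultimately show ?thesis using x by (simp add: power2_eq_square algebra_simps)
      qed
      ultimately show ?thesis using den
        by (simp add: W_def neg_less_divide_eq neg_divide_less_eq)
    qed
  qed (use E1 E2 in \<open>auto simp: U_def W_def\<close>)
qed

text \<open>For \<open>x = 1\<close> (that is, \<open>d = 2\<close>) the endpoints \<open>x / \<epsilon>\<close> are forced: the quadratic inequalities
  that an endpoint has to satisfy then have a double root. Below, \<open>s - x\<close> is \<open>1 / \<epsilon>\<close>.\<close>

lemma square_shape_free_neg:
  assumes t: "t = \<i> * of_real s" and r: "r = of_real x"
    and norm: "s\<^sup>2 = x\<^sup>2 + 1" and x: "x \<ge> 1" and s: "s > 0"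
    and u: "u = Quat r t 0 0" and w: "w = Quat (r\<^sup>2) (- (r * t)) (t\<^sup>2) (r * t)"
    and inv: "u' * u = 1" "w' * w = 1"
  shows "u \<noteq> w \<and> free_semigroup_on {u, w} (semigroup_gen {u, w})"
proof -
  define E f where "E = x + s" and "f = s - x"
  have Ef: "E * f = 1" using norm by (simp add: E_def f_def power2_eq_square algebra_simps)
  have xs: "x < s" by (rule power2_less_imp_less) (use norm s in auto)
  have E0: "E > 0" and f0: "f > 0" and sE: "s < E" using xs x by (auto simp: E_def f_def)
  have E1: "E \<ge> 1" and fE: "f \<le> E" using x s by (auto simp: E_def f_def)
  have Es: "E * s \<ge> 1" using E1 xs x by (intro mult_ge1_I) auto
  have EsEx: "E * s = 1 + E * x" using Ef by (simp add: f_def algebra_simps)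
  have fxs: "f * x + f * s = 1" using Ef by (simp add: E_def algebra_simps)
  moreover have "f * x < f * s" using f0 xs by simp
  ultimately have xf: "x * f < 1/2" by (simp add: mult.commute)
  \<comment> \<open>With \<open>u\<close> acting as \<open>z -> - E^2 * z\<close>, the ray beyond
    \<open>x * f\<close> goes exactly onto the ray below \<open>- (x * E)\<close>, and
    \<open>W\<close> goes into the ray beyond \<open>x * f\<close>. Moreover \<open>W\<close> is the
    image of the interval from \<open>x * f\<close> to \<open>x * E\<close> under
    \<open>v -> - f^2 * v\<close>.\<close>
  define U W where "U = {z. z > x * f \<or> z < - (x * E)}"
    and "W = {z. - (x * f) < z \<and> z < - (x * f * f\<^sup>2)}"
  have "x * f \<le> x * E" "0 < x * f" "0 < x * f * f\<^sup>2" using fE x f0 by auto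
  then have disj: "U \<inter> W = {}" unfolding U_def W_def by auto
  show ?thesis
  proof (rule mobius_ping_pong[where \<sigma> = "-1" and a = E and b = 0 and c = 0 and e = "- f"
        and a' = "- (x * f)" and b' = "- (s * f)" and c' = "s * E" and e' = "x * E"
        and U = U and W = W and ?z0.0 = "x * f + 1", OF _ inv])
    show "acts_as (-1) u E 0 0 (- f)"
      unfolding acts_as_def u r t E_def f_def by (intro exI[of _ 1]) (simp add: algebra_simps)
    show "acts_as (-1) w (- (x * f)) (- (s * f)) (s * E) (x * E)"
      unfolding acts_as_def w r t E_def f_def
      by (intro exI[of _ 1]) (simp add: power2_eq_square algebra_simps)
    fix z assume "z \<in> U \<union> W"
    then have z: "z > x * f \<or> z < - (x * E) \<or> - (x * f) < z \<and> z < - (x * f * f\<^sup>2)"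
      unfolding U_def W_def by auto
    have "E * z = - (E * E * z) * - f" using Ef by algebra
    then have uz: "E * z / - f = - (E * E * z)" using f0 by (simp add: divide_eq_eq)
    have "- (E * E * z) \<in> U"
      using z
    proof (elim disjE conjE)
      assume "z > x * f"
      then have "E * E * (x * f) < E * E * z" using E0 by (intro mult_strict_left_mono) auto
      moreover have "E * E * (x * f) = x * E" using Ef by algebra
      ultimately show ?thesis by (simp add: U_def)
    next
      assume "z < - (x * E)"
      then have "E * E * (x * E) < E * E * - z" using E0 by (intro mult_strict_left_mono) auto
      moreover have "x * f * 1 \<le> x * E * (E * E)"
        using x E1 fE f0 by (intro mult_mono) (auto simp: mult_ge1_I)
      ultimately show ?thesis by (simp add: U_def algebra_simps)
    next
      assume "z < - (x * f * f\<^sup>2)"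
      then have "E * E * (x * f * f\<^sup>2) < E * E * - z" using E0 by (intro mult_strict_left_mono) auto
      moreover have "E * E * (x * f * f\<^sup>2) = x * f" using Ef by algebra
      ultimately show ?thesis by (simp add: U_def)
    qed
    then show "0 * z + - f \<noteq> 0 \<and> (E * z + 0) / (0 * z + - f) \<in> U"
      using f0 uz by simp
    \<comment> \<open>Since \<open>w\<close> sends \<open>z\<close> to \<open>- f^2 * v\<close> with
      \<open>v = (x * z + s) / (s * z + x)\<close>, the claim about \<open>W\<close> amounts to
      these two bounds on \<open>v\<close>.\<close>
    have "s * z + x \<noteq> 0 \<and> x * f < (x * z + s) / (s * z + x) \<and> (x * z + s) / (s * z + x) < x * E"
      using z
    proof (elim disjE conjE)
      assume z: "z > x * f"
      then have z0: "z > 0" using x f0 by (smt (verit) mult_pos_pos)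
      then have den: "s * z + x > 0" using s x by (simp add: add_pos_pos)
      have "x * f * (s * z + x) < x * z + s"
      proof -
        have "x * z + s - x * f * (s * z + x) = x * z * (x * f) + (s - x * (x * f))"
          using fxs by algebra
        moreover have "x * z * (x * f) > 0" using x z0 f0 by simp
        moreover have "x * (x * f) \<le> x * 1" using x xf by (intro mult_left_mono) auto
        ultimately show ?thesis using xs by linarith
      qed
      moreover have "x * z + s < x * E * (s * z + x)"
      proof -
        have "1 * (x * z) \<le> E * s * (x * z)" using Es x z0 by (intro mult_right_mono) auto
        moreover have "1 * E \<le> x * x * E" using x E0 by (intro mult_right_mono) (auto simp: mult_ge1_I)
        ultimately show ?thesis using sE by (simp add: algebra_simps)
      qed
      ultimately show ?thesis using den by (simp add: pos_less_divide_eq pos_divide_less_eq)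
    next
      assume z: "z < - (x * E)"
      define m where "m = - z"
      have m: "m > x * E" using z by (simp add: m_def)
      have "1 * 1 \<le> x * E" using x E1 by (intro mult_mono) auto
      with m have m1: "m > 1" by simp
      have "s * (x * E) < s * m" using m s by simp
      moreover have "1 * x \<le> E * s * x" using Es x by (intro mult_right_mono) auto
      ultimately have den: "s * m - x > 0" by (simp add: algebra_simps)
      have "x * f * (s * m - x) < x * m - s"
      proof -
        \<comment> \<open>At the endpoint \<open>m = x * E\<close> this difference equals
          \<open>(x^2 - 1) * s\<close>, which is 0 for \<open>x = 1\<close>; only the strictness of
          \<open>m > x * E\<close> is left then.\<close>
        have "x * m - s - x * f * (s * m - x) = m * (x * x * f) + (x * x * f - s)"
          using fxs by algebra
        moreover have "x * E * (x * x * f) = x * x * x" using Ef by algebra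
        moreover have "x * x * f = x * x * s - x * x * x" by (simp add: f_def algebra_simps)
        moreover have "x * E * (x * x * f) < m * (x * x * f)"
          using m x f0 by (intro mult_strict_right_mono) auto
        moreover have "1 * s \<le> x * x * s" using x s by (intro mult_right_mono) (auto simp: mult_ge1_I)
        ultimately show ?thesis by linarith
      qed
      moreover have "x * m - s < x * E * (s * m - x)"
      proof -
        have "x * E * (s * m - x) - (x * m - s) = (m - 1) * (x * x * E) + s"
          using EsEx by algebra
        moreover have "(m - 1) * (x * x * E) > 0" using m1 x E0 by simp
        ultimately show ?thesis using s by linarith
      qed
      moreover have "(x * z + s) / (s * z + x) = (x * m - s) / (s * m - x)"
      proof -
        have "x * z + s = - (x * m - s)" "s * z + x = - (s * m - x)" by (simp_all add: m_def)
        then show ?thesis by (simp only: minus_divide_divide)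
      qed
      moreover have "s * z + x \<noteq> 0" using den by (simp add: m_def)
      ultimately show ?thesis
        by (simp only: pos_less_divide_eq[OF den] pos_divide_less_eq[OF den]) simp
    next
      assume z: "- (x * f) < z"  "z < - (x * f * f\<^sup>2)"
      define m where "m = - z"
      have m: "m < x * f" using z by (simp add: m_def)
      have "s * m < s * (x * f)" using m s by simp
      moreover have "x - s * (x * f) = x * (x * f)" using fxs by algebra
      moreover have "x * (x * f) > 0" using x f0 by simp
      ultimately have den: "x - s * m > 0" by linarith
      have "x * f * (x - s * m) < s - x * m"
      proof -
        have "s - x * m - x * f * (x - s * m) = s - x * (x * f) - m * (x * (x * f))"
          using fxs by algebra
        moreover have "m * (x * (x * f)) < x * f * (x * (x * f))"
          using m x f0 by (intro mult_strict_right_mono) auto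
        moreover have "x * (x * f) \<le> x * (1/2)" using x xf by (intro mult_left_mono) auto
        moreover have "x * f * (x * (x * f)) \<le> 1 * (x * (1/2))"
          using x xf f0 by (intro mult_mono) auto
        ultimately show ?thesis using xs by linarith
      qed
      moreover have "s - x * m < x * E * (x - s * m)"
      proof -
        \<comment> \<open>The value at the endpoint \<open>m = x * f\<close> is again
          \<open>(x^2 - 1) * s\<close>, so strictness for \<open>x = 1\<close> comes from
          \<open>m < x * f\<close>.\<close>
        have "x * E * (x - s * m) - (s - x * m) = x * x * E - s - m * (x * x * E)"
          using EsEx by algebra
        moreover have "m * (x * x * E) < x * f * (x * x * E)"
          using m x E0 by (intro mult_strict_right_mono) auto
        moreover have "x * f * (x * x * E) = x * x * x" using Ef by algebra
        moreover have "x * x * E = x * x * x + x * x * s" by (simp add: E_def algebra_simps)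
        moreover have "1 * s \<le> x * x * s" using x s by (intro mult_right_mono) (auto simp: mult_ge1_I)
        ultimately show ?thesis by linarith
      qed
      moreover have "x * z + s = s - x * m" "s * z + x = x - s * m" by (simp_all add: m_def)
      ultimately show ?thesis
        using den by (simp only: pos_less_divide_eq[OF den] pos_divide_less_eq[OF den]) simp
    qed
    then obtain v where v: "v = (x * z + s) / (s * z + x)" "s * z + x \<noteq> 0" "x * f < v" "v < x * E"
      by blast
    have "(- (x * f) * z + - (s * f)) / (s * E * z + x * E) = - (f * f * v)"
    proof -
      have "- (x * f) * z + - (s * f) = - (f * f * (x * z + s)) * E"
        using Ef by algebra
      moreover have "s * E * z + x * E = (s * z + x) * E" by (simp add: algebra_simps)
      ultimately show ?thesis using E0 by (simp add: v(1))
    qed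
    moreover have "f * f * (x * f) < f * f * v" "f * f * v < f * f * (x * E)"
      using v(3,4) f0 by (auto intro!: mult_strict_left_mono)
    moreover have "f * f * (x * E) = x * f" using Ef by algebra
    moreover have "s * E * z + x * E = E * (s * z + x)" by (simp add: algebra_simps)
    then have "s * E * z + x * E \<noteq> 0" using v(2) E0 by simp
    moreover have "f * f * (x * f) = x * f * f\<^sup>2" by (simp add: power2_eq_square)
    ultimately show "s * E * z + x * E \<noteq> 0 \<and> (- (x * f) * z + - (s * f)) / (s * E * z + x * E) \<in> W"
      unfolding W_def by simp
  qed (use disj in \<open>auto simp: U_def\<close>)
qed

section \<open>Integrality\<close>

lemma poly_even_odd_parts:
  fixes p :: "'a::comm_ring_1 poly"
  obtains e h where "\<And>z. poly p z = poly e (z\<^sup>2) + z * poly h (z\<^sup>2)"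
    and "\<And>k. coeff e k = coeff p (2 * k)" and "\<And>k. coeff h k = coeff p (2 * k + 1)"
proof -
  have "\<exists>e h. (\<forall>z. poly p z = poly e (z\<^sup>2) + z * poly h (z\<^sup>2)) \<and>
          (\<forall>k. coeff e k = coeff p (2 * k)) \<and> (\<forall>k. coeff h k = coeff p (2 * k + 1))"
  proof (induction p)
    case 0
    show ?case by (intro exI[of _ 0]) auto
  next
    case (pCons a p)
    then obtain e h where eh: "\<And>z. poly p z = poly e (z\<^sup>2) + z * poly h (z\<^sup>2)"
      "\<And>k. coeff e k = coeff p (2 * k)" "\<And>k. coeff h k = coeff p (2 * k + 1)" by blast
    \<comment> \<open>Prepending a coefficient shifts all degrees by one, so the even and odd parts
      exchange roles.\<close>
    show ?case
    proof (intro exI conjI allI)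
      show "poly (pCons a p) z = poly (pCons a h) (z\<^sup>2) + z * poly e (z\<^sup>2)" for z
        by (simp add: eh(1) power2_eq_square algebra_simps)
      show "coeff (pCons a h) k = coeff (pCons a p) (2 * k)" for k
        by (cases k) (simp_all add: eh(3))
      show "coeff e k = coeff (pCons a p) (2 * k + 1)" for k
        by (simp add: eh(2))
    qed
  qed
  then show ?thesis using that by blast
qed

text \<open>Conjugation shows that \<open>- z\<close> is a root of the same polynomial, so its even
  and odd parts both vanish at \<open>z^2\<close>. The part matching the parity of the degree
  inherits the leading coefficient 1.\<close>

lemma algebraic_int_square_imaginary:
  fixes z :: complex
  assumes z: "algebraic_int z" and imag: "cnj z = - z"
  shows "algebraic_int (z\<^sup>2)"
proof (cases "z = 0")
  case False
  from z obtain p where p: "lead_coeff p = 1" "\<forall>i. coeff p i \<in> \<int>" "poly p z = 0"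
    by (auto elim: algebraic_int.cases)
  obtain e h where eh: "\<And>z. poly p z = poly e (z\<^sup>2) + z * poly h (z\<^sup>2)"
    "\<And>k. coeff e k = coeff p (2 * k)" "\<And>k. coeff h k = coeff p (2 * k + 1)"
    using poly_even_odd_parts by blast
  have "coeff p i \<in> \<real>" for i using p(2) by (metis Ints_cases Reals_of_int)
  then have "poly p (- z) = 0"
    using poly_cnj_real[of p z] p(3) imag by simp
  then have "poly e (z\<^sup>2) = 0" "poly h (z\<^sup>2) = 0"
    using eh(1)[of z] eh(1)[of "- z"] p(3) False by (auto simp: algebra_simps)
  moreover have "lead_coeff e = 1 \<or> lead_coeff h = 1"
  proof -
    have top: "coeff p i = 0" if "i > degree p" for i using that by (rule coeff_eq_0)
    show ?thesis
    proof (cases "even (degree p)")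
      case True
      then have "coeff e (degree p div 2) = 1" using p(1) eh(2) by simp
      moreover from this have "degree e = degree p div 2"
        by (intro antisym degree_le le_degree) (auto simp: eh(2) intro!: top)
      ultimately show ?thesis by simp
    next
      case False
      then have "coeff h (degree p div 2) = 1" using p(1) eh(3) by simp
      moreover from this have "degree h = degree p div 2"
        by (intro antisym degree_le le_degree) (auto simp: eh(3) intro!: top)
      ultimately show ?thesis by simp
    qed
  qed
  moreover have "\<forall>i. coeff e i \<in> \<int>" "\<forall>i. coeff h i \<in> \<int>" using p(2) eh(2,3) by simp_all
  ultimately show ?thesis by (blast intro: algebraic_int.intros)
qed auto

section \<open>The ring of integral combinations of 1 and \<open>\<tau>\<close>, and its
  units\<close>

definition adjoin_int :: "'a::comm_ring_1 \<Rightarrow> 'a set" where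
  "adjoin_int \<tau> = {of_int m + of_int n * \<tau> | m n. True}"

lemma adjoin_intI: "z = of_int m + of_int n * \<tau> \<Longrightarrow> z \<in> adjoin_int \<tau>"
  by (auto simp: adjoin_int_def)

lemma of_int_in_adjoin_int [simp]: "of_int m \<in> adjoin_int \<tau>"
  by (rule adjoin_intI[of _ m 0]) simp

lemma one_in_adjoin_int [simp]: "1 \<in> adjoin_int \<tau>" and zero_in_adjoin_int [simp]: "0 \<in> adjoin_int \<tau>"
  using of_int_in_adjoin_int[of 1] of_int_in_adjoin_int[of 0] by auto

lemma self_in_adjoin_int [simp]: "\<tau> \<in> adjoin_int \<tau>"
  by (rule adjoin_intI[of _ 0 1]) simp

lemma adjoin_int_add: "a \<in> adjoin_int \<tau> \<Longrightarrow> b \<in> adjoin_int \<tau> \<Longrightarrow> a + b \<in> adjoin_int \<tau>"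
proof -
  assume "a \<in> adjoin_int \<tau>" "b \<in> adjoin_int \<tau>"
  then obtain m n m' n' where "a = of_int m + of_int n * \<tau>" "b = of_int m' + of_int n' * \<tau>"
    by (auto simp: adjoin_int_def)
  then show ?thesis by (intro adjoin_intI[of _ "m + m'" "n + n'"]) (simp add: algebra_simps)
qed

lemma adjoin_int_uminus: "a \<in> adjoin_int \<tau> \<Longrightarrow> - a \<in> adjoin_int \<tau>"
proof -
  assume "a \<in> adjoin_int \<tau>"
  then obtain m n where "a = of_int m + of_int n * \<tau>" by (auto simp: adjoin_int_def)
  then show ?thesis by (intro adjoin_intI[of _ "- m" "- n"]) simp
qed

lemma adjoin_int_diff: "a \<in> adjoin_int \<tau> \<Longrightarrow> b \<in> adjoin_int \<tau> \<Longrightarrow> a - b \<in> adjoin_int \<tau>"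
  using adjoin_int_add[of a \<tau> "- b"] adjoin_int_uminus[of b \<tau>] by simp

lemma adjoin_int_mult:
  assumes \<tau>: "\<tau>\<^sup>2 = of_int c" and "a \<in> adjoin_int \<tau>" "b \<in> adjoin_int \<tau>"
  shows "a * b \<in> adjoin_int \<tau>"
proof -
  from assms obtain m n m' n' where "a = of_int m + of_int n * \<tau>" "b = of_int m' + of_int n' * \<tau>"
    by (auto simp: adjoin_int_def)
  then have "a * b = of_int (m * m') + of_int (m * n' + n * m') * \<tau> + of_int (n * n') * \<tau>\<^sup>2"
    by (simp add: algebra_simps power2_eq_square)
  then show ?thesis
    by (intro adjoin_intI[of _ "m * m' + n * n' * c" "m * n' + n * m'"]) (simp add: \<tau> algebra_simps)
qed

lemma adjoin_int_power:
  assumes "\<tau>\<^sup>2 = of_int c" "a \<in> adjoin_int \<tau>"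
  shows "a ^ n \<in> adjoin_int \<tau>"
  by (induction n) (use assms adjoin_int_mult in auto)

lemma adjoin_int_sum:
  assumes "\<And>i. i \<in> A \<Longrightarrow> f i \<in> adjoin_int \<tau>"
  shows "sum f A \<in> adjoin_int \<tau>"
  using assms by (induction A rule: infinite_finite_induct) (auto intro: adjoin_int_add)

lemma algebraic_int_adjoin_int:
  fixes \<tau> :: "'a::field_char_0"
  assumes \<tau>: "\<tau>\<^sup>2 = of_int c" and "a \<in> adjoin_int \<tau>"
  shows "algebraic_int a"
proof -
  from assms obtain m n where a: "a = of_int m + of_int n * \<tau>" by (auto simp: adjoin_int_def)
  \<comment> \<open>This is \<open>(T - m)^2 - n^2 * c\<close> as a polynomial in
    \<open>T\<close>.\<close>
  let ?p = "[:of_int (m\<^sup>2 - n\<^sup>2 * c), of_int (- 2 * m), 1:] :: 'a poly"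
  show ?thesis
  proof (rule algebraic_int.intros)
    show "poly ?p a = 0"
      unfolding a using \<tau> by (simp add: power2_eq_square algebra_simps)
    show "\<forall>i. coeff ?p i \<in> \<int>" by (simp add: coeff_pCons split: nat.splits)
  qed simp
qed

text \<open>Multiplying a monic integral equation of degree \<open>n\<close> for \<open>1 / a\<close> by \<open>a ^ (n - 1)\<close> expresses
  \<open>1 / a\<close> as an integral polynomial in \<open>a\<close>.\<close>

lemma inverse_in_adjoin_int:
  fixes \<tau> :: "'a::field_char_0"
  assumes \<tau>: "\<tau>\<^sup>2 = of_int c" and a: "a \<in> adjoin_int \<tau>" and b: "algebraic_int b" and ab: "a * b = 1"
  shows "b \<in> adjoin_int \<tau>"
proof -
  from b obtain p where p: "lead_coeff p = 1" "\<forall>i. coeff p i \<in> \<int>" "poly p b = 0"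
    by (auto elim: algebraic_int.cases)
  have "degree p \<noteq> 0"
  proof
    assume "degree p = 0"
    then obtain k where "p = [:k:]" by (elim degree_eq_zeroE)
    then show False using p by simp
  qed
  then obtain n where n: "degree p = Suc n" by (cases "degree p") auto
  have cancel: "b ^ i * a ^ n = a ^ (n - i)" if "i \<le> n" for i
  proof -
    have "b ^ i * a ^ n = (a * b) ^ i * a ^ (n - i)"
      using that by (simp add: power_mult_distrib power_add[symmetric] mult_ac)
    then show ?thesis by (simp add: ab)
  qed
  have "0 = (\<Sum>i\<le>Suc n. coeff p i * b ^ i) * a ^ n"
    using p(3) by (simp add: poly_altdef n)
  also have "\<dots> = (\<Sum>i\<le>n. coeff p i * (b ^ i * a ^ n)) + b * (b ^ n * a ^ n)"
    using p(1) by (simp add: n algebra_simps sum_distrib_left sum_distrib_right)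
  also have "\<dots> = (\<Sum>i\<le>n. coeff p i * a ^ (n - i)) + b"
    by (simp add: cancel)
  finally have "b = - (\<Sum>i\<le>n. coeff p i * a ^ (n - i))" by (simp add: eq_neg_iff_add_eq_0 add.commute)
  moreover have "coeff p i \<in> adjoin_int \<tau>" for i using p(2) by (metis Ints_cases of_int_in_adjoin_int)
  ultimately show ?thesis
    by (auto intro!: adjoin_int_uminus adjoin_int_sum adjoin_int_mult[OF \<tau>] adjoin_int_power[OF \<tau> a])
qed

text \<open>The inverse has the form \<open>m + n * s\<close>. As \<open>s\<close> is irrational,
  comparing coefficients gives \<open>m = - n * X\<close> and then
  \<open>n * (X^2 - D) = -1\<close>, so the norm divides 1.\<close>

lemma unit_norm:
  fixes s :: real
  assumes s: "s\<^sup>2 = of_int D" "s \<notin> \<rat>" and b: "algebraic_int b" "(of_int X + s) * b = 1"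
  shows "X\<^sup>2 - D = 1 \<or> X\<^sup>2 - D = - 1"
proof -
  have "of_int X + s \<in> adjoin_int s" by (rule adjoin_intI[of _ X 1]) simp
  from inverse_in_adjoin_int[OF s(1) this b] obtain m n where bmn: "b = of_int m + of_int n * s"
    by (auto simp: adjoin_int_def)
  have "of_int (X * m - 1) + of_int n * s\<^sup>2 + of_int (m + n * X) * s = 0"
    using b(2) unfolding bmn by (simp add: algebra_simps power2_eq_square)
  then have eq: "of_int (X * m + n * D - 1) + of_int (m + n * X) * s = 0"
    unfolding s(1) by simp
  have "m + n * X = 0"
  proof (rule ccontr)
    assume "m + n * X \<noteq> 0"
    then have nz: "real_of_int (m + n * X) \<noteq> 0" by (simp only: of_int_eq_0_iff not_False_eq_True)
    have "of_int (m + n * X) * s = - of_int (X * m + n * D - 1)" using eq by linarith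
    then have "s = - of_int (X * m + n * D - 1) / of_int (m + n * X)"
      using nz by (metis nonzero_mult_div_cancel_left)
    then have "s \<in> \<rat>"
      by (simp del: of_int_add of_int_diff of_int_mult)
    with s(2) show False ..
  qed
  then have m: "m = - n * X" by simp
  have "of_int (X * m + n * D - 1) = (0::real)"
    using eq unfolding \<open>m + n * X = 0\<close> by simp
  then have "X * m + n * D - 1 = 0" by (simp only: of_int_eq_0_iff)
  then have "n * (X\<^sup>2 - D) = - 1" unfolding m by (simp add: power2_eq_square algebra_simps)
  then have "(X\<^sup>2 - D) * - n = 1" by (simp add: mult.commute)
  then have "is_unit (X\<^sup>2 - D)" by (metis dvd_triv_left)
  then show ?thesis unfolding zdvd1_eq by linarith
qed

lemma sqrt_squarefree_irrational:
  fixes d :: int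
  assumes "d > 1" "squarefree d"
  shows "sqrt (of_int d) \<notin> \<rat>"
proof
  assume "sqrt (of_int d) \<in> \<rat>"
  then have "sqrt (of_int d) \<in> \<int>"
    by (intro rational_algebraic_int_is_int) auto
  then obtain m where "sqrt (of_int d) = of_int m" by (auto elim: Ints_cases)
  then have "(sqrt (of_int d))\<^sup>2 = of_int (m\<^sup>2)" by simp
  then have "real_of_int d = of_int (m\<^sup>2)" using assms(1) by simp
  then have dm: "d = m\<^sup>2" by (simp only: of_int_eq_iff)
  then have "is_unit m" using squarefreeD[OF assms(2), of m] by simp
  then have "is_unit d" unfolding dm by (simp only: is_unit_power_iff simp_thms)
  with assms(1) show False by simp
qed

lemma algebraic_int_of_rat:
  assumes "algebraic_int (of_rat q :: 'a::field_char_0)"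
  obtains n where "q = of_int n"
proof -
  from rational_algebraic_int_is_int[OF assms] obtain n where "of_rat q = (of_int n :: 'a)"
    by (auto elim: Ints_cases)
  then have "q = of_int n" by (metis of_rat_eq_iff of_rat_of_int_eq)
  then show ?thesis by (rule that)
qed

section \<open>Units of quaternion orders\<close>

lemma Quat_in_quat_over_iff:
  "Quat a b c e \<in> quat_over S \<longleftrightarrow> a \<in> S \<and> b \<in> S \<and> c \<in> S \<and> e \<in> S"
  by (simp add: quat_over_def)

lemma quat_over_adjoin_int_mult:
  assumes "\<tau>\<^sup>2 = of_int c" "p \<in> quat_over (adjoin_int \<tau>)" "q \<in> quat_over (adjoin_int \<tau>)"
  shows "p * q \<in> quat_over (adjoin_int \<tau>)"
  using assms(2,3) unfolding quat_over_def times_quat_def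
  by clarsimp (intro conjI adjoin_int_add adjoin_int_diff adjoin_int_mult[OF assms(1)]; assumption)

text \<open>The inverse is the conjugate divided by the norm; a norm of 1 or -1 is its own inverse,
  which is \<open>\<nu>\<close>.\<close>

lemma units_in_quat_over:
  assumes q: "Quat a b c e \<in> quat_over (adjoin_int \<tau>)"
    and norm: "a\<^sup>2 + b\<^sup>2 + c\<^sup>2 + e\<^sup>2 = 1 \<or> a\<^sup>2 + b\<^sup>2 + c\<^sup>2 + e\<^sup>2 = - 1"
  shows "Quat a b c e \<in> units_in (quat_over (adjoin_int \<tau>))"
proof -
  obtain \<nu> where nu: "\<nu> = 1 \<or> \<nu> = - 1" "\<nu> * (a\<^sup>2 + b\<^sup>2 + c\<^sup>2 + e\<^sup>2) = 1"
    using norm by (elim disjE) (auto intro: that[of 1] that[of "- 1"])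
  let ?i = "Quat (\<nu> * a) (- (\<nu> * b)) (- (\<nu> * c)) (- (\<nu> * e))"
  have "?i \<in> quat_over (adjoin_int \<tau>)"
    using q nu(1) by (auto simp: quat_over_def intro: adjoin_int_uminus)
  moreover have "Quat a b c e * ?i = 1" "?i * Quat a b c e = 1"
    using nu(2) by (simp_all add: times_quat_def one_quat_def algebra_simps power2_eq_square)
  ultimately show ?thesis using q unfolding units_in_def by blast
qed

lemma units_in_mult:
  assumes "\<And>p q. p \<in> R \<Longrightarrow> q \<in> R \<Longrightarrow> p * q \<in> R" "p \<in> units_in R" "q \<in> units_in R"
  shows "p * q \<in> units_in R"
proof -
  from assms obtain p' q' where inv: "p' \<in> R" "p * p' = 1" "p' * p = 1"
    "q' \<in> R" "q * q' = 1" "q' * q = 1" "p \<in> R" "q \<in> R" unfolding units_in_def by blast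
  have "p * q * (q' * p') = p * (q * q') * p'" "q' * p' * (p * q) = q' * (p' * p) * q"
    by (simp_all only: mult.assoc)
  then have "p * q * (q' * p') = 1" "q' * p' * (p * q) = 1" using inv by simp_all
  with inv assms(1) show ?thesis unfolding units_in_def by blast
qed

lemma semigroup_gen_subset:
  assumes "\<And>p q. p \<in> T \<Longrightarrow> q \<in> T \<Longrightarrow> p * q \<in> T" "B \<subseteq> T"
  shows "semigroup_gen B \<subseteq> T"
proof
  fix a assume "a \<in> semigroup_gen B"
  then show "a \<in> T" by induction (use assms in auto)
qed

section \<open>Freeness\<close>

theorem theorem3p13:
  fixes d :: int and x y :: rat and r t :: complex and u w :: "complex quat"
    and O\<^sub>K :: "complex set"
  assumes "d > 1" and "squarefree d"
    and "O\<^sub>K = ring_of_integers (quad_field (csqrt (- of_int d)))"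
    and "fundamental_unit (ring_of_integers (quad_field (sqrt (of_int d))))
           (of_rat x + of_rat y * sqrt (of_int d))"
    and "x > 0" and "y > 0"
    and "r = of_rat x" and "t = of_rat y * csqrt (- of_int d)"
    and "u = Quat r t 0 0"
    and "w \<in> {Quat t 0 0 r,
              Quat ((r + 1) / 2) (- t / 2) ((r - 1) / 2) (t / 2),
              Quat (r\<^sup>2) (- (r * t)) (- (of_rat (y\<^sup>2) * of_int d)) (r * t)}"
    and "w \<in> quat_over O\<^sub>K"
  shows "semigroup_gen {u, w} \<subseteq> units_in (quat_over O\<^sub>K)
         \<and> u \<noteq> w \<and> free_semigroup_on {u, w} (semigroup_gen {u, w})"
proof -
  define s where "s = of_rat y * sqrt (real_of_int d)"
  define K where "K = quad_field (csqrt (- complex_of_int d))"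
  note d = assms(1) and w = assms(10)
  have O: "O\<^sub>K = {z \<in> K. algebraic_int z}"
    using assms(3) by (simp add: ring_of_integers_def K_def)
  have "csqrt (- complex_of_int d) = \<i> * of_real (sqrt (of_int d))"
    using d by simp
  moreover have "complex_of_real (of_rat y) = of_rat y"
    by (cases y) (simp add: of_rat_rat)
  ultimately have t: "t = \<i> * of_real s"
    using assms(8) by (simp add: s_def)
  have s2y: "s\<^sup>2 = of_rat (y\<^sup>2 * of_int d)"
    using d by (simp add: s_def power_mult_distrib of_rat_mult of_rat_power)
  have t2: "t\<^sup>2 = of_rat (- (y\<^sup>2 * of_int d))"
    using assms(8) by (simp add: power_mult_distrib of_rat_mult of_rat_power of_rat_minus)
  have t_imag: "cnj t = - t" by (simp add: t)
  have s0: "s > 0" using assms(6) d by (simp add: s_def)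
  have s_irrat: "s \<notin> \<rat>"
  proof
    assume "s \<in> \<rat>"
    then have "s / of_rat y \<in> \<rat>" by (intro Rats_divide) auto
    moreover have "s / of_rat y = sqrt (of_int d)" using assms(6) by (simp add: s_def)
    ultimately show False using sqrt_squarefree_irrational[OF d assms(2)] by simp
  qed
  define halved where "halved \<longleftrightarrow> w = Quat ((r + 1) / 2) (- t / 2) ((r - 1) / 2) (t / 2)"
  \<comment> \<open>Coordinates of \<open>w\<close> give rational algebraic integers. In the second
    shape these are \<open>(x + 1) / 2\<close> and \<open>(t / 2)^2\<close>, whence the parity
    statements; in the other shapes they are \<open>r\<close> and \<open>t^2\<close>, directly or
    through a square or square root.\<close>
  have integral: "\<exists>X D. x = of_int X \<and> y\<^sup>2 * of_int d = of_int D \<and> (halved \<longrightarrow> odd X \<and> 4 dvd D)"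
  proof -
    have coords: "algebraic_int (quat1 w)" "algebraic_int (quatj w)" "algebraic_int (quatk w)"
      using assms(11) unfolding quat_over_def O by auto
    show ?thesis
    proof (cases halved)
      case True
      then have w': "w = Quat ((r + 1) / 2) (- t / 2) ((r - 1) / 2) (t / 2)" by (simp add: halved_def)
      have "(r + 1) / 2 = of_rat ((x + 1) / 2)"
        using assms(7) by (simp add: of_rat_divide of_rat_add)
      then obtain m where m: "(x + 1) / 2 = of_int m"
        using coords(1) w' algebraic_int_of_rat by (metis quat.sel(1))
      have "algebraic_int ((t / 2)\<^sup>2)"
        using coords(3) w' t_imag by (intro algebraic_int_square_imaginary) auto
      moreover have "(t / 2)\<^sup>2 = of_rat (- (y\<^sup>2 * of_int d) / 4)"
        unfolding power_divide t2 of_rat_divide by simp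
      ultimately obtain c where c: "- (y\<^sup>2 * of_int d) / 4 = of_int c"
        using algebraic_int_of_rat by metis
      show ?thesis
      proof (intro exI conjI impI)
        show "x = of_int (2 * m - 1)" using m by simp
        show "y\<^sup>2 * of_int d = of_int (4 * - c)" using c by simp
      qed auto
    next
      case False
      have "algebraic_int r \<and> algebraic_int (t\<^sup>2)"
      proof (cases "w = Quat t 0 0 r")
        case True
        then show ?thesis using coords algebraic_int_square_imaginary[OF _ t_imag] by simp
      next
        case False
        with \<open>\<not> halved\<close> w have w':
          "w = Quat (r\<^sup>2) (- (r * t)) (- (of_rat (y\<^sup>2) * of_int d)) (r * t)"
          by (auto simp: halved_def)
        have "complex_of_real (of_rat x) = of_rat x" by (cases x) (simp add: of_rat_rat)
        \<comment> \<open>As \<open>x\<close> is positive, the principal root of \<open>r^2\<close>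
          is \<open>r\<close> itself, so integrality passes from \<open>r^2\<close> to
          \<open>r\<close>.\<close>
        then have "csqrt (r\<^sup>2) = r"
          using assms(7) assms(5) by (intro csqrt_square disjI1) (metis Re_complex_of_real zero_less_of_rat_iff)
        then have "algebraic_int r" using coords(1) w' algebraic_int_csqrt by (metis quat.sel(1))
        moreover have "quatj w = t\<^sup>2" by (simp add: w' t2 of_rat_minus of_rat_mult)
        ultimately show ?thesis using coords(2) by simp
      qed
      with algebraic_int_of_rat obtain X c where "x = of_int X" "- (y\<^sup>2 * of_int d) = of_int c"
        using assms(7) t2 by metis
      then show ?thesis using False by (intro exI[of _ X] exI[of _ "- c"]) (simp flip: minus_equation_iff)
    qed
  qed
  then obtain X D where X: "x = of_int X" and D: "y\<^sup>2 * of_int d = of_int D"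
    and half: "halved \<Longrightarrow> odd X \<and> 4 dvd D" by blast
  have rX: "r = of_real (of_int X)" and s2: "s\<^sup>2 = of_int D" and t2': "t\<^sup>2 = of_int (- D)"
    using assms(7) s2y t2 by (simp_all add: X D of_rat_minus)
  have wX: "w \<in> {Quat t 0 0 r, Quat ((r + 1) / 2) (- t / 2) ((r - 1) / 2) (t / 2),
      Quat (r\<^sup>2) (- (r * t)) (t\<^sup>2) (r * t)}"
    using w by (simp add: t2 of_rat_minus of_rat_mult)
  have X1: "X \<ge> 1" using assms(5) X by simp
  have D0: "D > 0" using s0 s2 by (metis of_int_0_less_iff zero_less_power)

  have "of_int X + s \<in> units_in (ring_of_integers (quad_field (sqrt (of_int d))))"
    using assms(4) by (simp add: fundamental_unit_def X s_def)
  then obtain b where "algebraic_int b" "(of_int X + s) * b = 1"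
    by (auto simp: units_in_def ring_of_integers_def)
  from unit_norm[OF s2 s_irrat this] have N: "X\<^sup>2 - D = 1 \<or> X\<^sup>2 - D = - 1" .
  \<comment> \<open>With \<open>X\<close> odd and \<open>D\<close> divisible by 4, the norm is 1
    modulo 4.\<close>
  have not_halved: "\<not> halved" if "X\<^sup>2 - D = - 1"
  proof
    assume halved
    then obtain k c where "X = 2 * k + 1" "D = 4 * c" using half by (meson dvdE oddE)
    with that have "4 * k\<^sup>2 + 4 * k + 2 = 4 * c" by (simp add: power2_eq_square algebra_simps)
    then show False by presburger
  qed

  have rt: "r\<^sup>2 + t\<^sup>2 = 1 \<or> r\<^sup>2 + t\<^sup>2 = - 1"
  proof -
    have "r\<^sup>2 + t\<^sup>2 = of_int (X\<^sup>2 - D)" by (simp add: rX t2')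
    with N show ?thesis by (elim disjE) (simp_all del: of_int_diff of_int_power)
  qed
  \<comment> \<open>Chosen so that \<open>\<tau>^2\<close> is an integer and all coordinates of
    \<open>u\<close> and \<open>w\<close> are integral combinations of 1 and
    \<open>\<tau>\<close>.\<close>
  define \<tau> where "\<tau> = (if halved then t / 2 else t)"
  obtain c where \<tau>2: "\<tau>\<^sup>2 = of_int c"
  proof (cases halved)
    case True
    then obtain k where "D = 4 * k" using half by auto
    then have "\<tau>\<^sup>2 = of_int (- k)" using True t2' by (simp add: \<tau>_def power_divide)
    then show ?thesis by (rule that)
  next
    case False
    then show ?thesis using that[of "- D"] t2' by (simp add: \<tau>_def)
  qed
  have r_in: "r \<in> adjoin_int \<tau>" by (simp add: rX)
  have t_in: "t \<in> adjoin_int \<tau>"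
    by (cases halved) (auto simp: \<tau>_def intro: adjoin_intI[of _ 0 2])
  note closed = adjoin_int_uminus adjoin_int_mult[OF \<tau>2] adjoin_int_power[OF \<tau>2]
  have "u \<in> units_in (quat_over (adjoin_int \<tau>))"
    unfolding assms(9)
    by (rule units_in_quat_over) (use r_in t_in rt in \<open>auto simp: Quat_in_quat_over_iff\<close>)
  moreover have "w \<in> units_in (quat_over (adjoin_int \<tau>))"
  proof (cases halved)
    case True
    then have w': "w = Quat ((r + 1) / 2) (- t / 2) ((r - 1) / 2) (t / 2)" by (simp add: halved_def)
    obtain k where k: "X = 2 * k + 1" using half[OF True] by (auto elim: oddE)
    have "(r + 1) / 2 = of_int (k + 1)" "(r - 1) / 2 = of_int k" by (simp_all add: rX k)
    then have "(r + 1) / 2 \<in> adjoin_int \<tau>" "(r - 1) / 2 \<in> adjoin_int \<tau>"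
      by (metis of_int_in_adjoin_int)+
    moreover have "t / 2 \<in> adjoin_int \<tau>" using True by (simp add: \<tau>_def[symmetric] \<tau>_def)
    moreover from this have "- t / 2 \<in> adjoin_int \<tau>" using adjoin_int_uminus by fastforce
    \<comment> \<open>The quaternion norm is \<open>(r^2 + t^2 + 1) / 2\<close>, which is why
      \<open>r^2 + t^2 = 1\<close> has to be secured first.\<close>
    moreover have "((r + 1) / 2)\<^sup>2 + (- t / 2)\<^sup>2 + ((r - 1) / 2)\<^sup>2 + (t / 2)\<^sup>2 = 1"
    proof -
      have "X\<^sup>2 - D = 1" using N not_halved True by blast
      then have "complex_of_int (X\<^sup>2 - D) = 1" by (simp only: of_int_1)
      then have "r\<^sup>2 + t\<^sup>2 = 1" by (simp add: rX t2')
      moreover have "((r + 1) / 2)\<^sup>2 + (- t / 2)\<^sup>2 + ((r - 1) / 2)\<^sup>2 + (t / 2)\<^sup>2 = (r\<^sup>2 + t\<^sup>2 + 1) / 2"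
        by (simp add: field_simps power2_eq_square)
      ultimately show ?thesis by simp
    qed
    ultimately show ?thesis
      unfolding w' by (intro units_in_quat_over) (simp_all only: Quat_in_quat_over_iff simp_thms)
  next
    case False
    then have "w = Quat t 0 0 r \<or> w = Quat (r\<^sup>2) (- (r * t)) (t\<^sup>2) (r * t)"
      using wX by (auto simp: halved_def)
    then show ?thesis
    proof
      assume w': "w = Quat t 0 0 r"
      show ?thesis
        unfolding w' by (rule units_in_quat_over) (use r_in t_in rt in \<open>auto simp: Quat_in_quat_over_iff add.commute\<close>)
    next
      assume w': "w = Quat (r\<^sup>2) (- (r * t)) (t\<^sup>2) (r * t)"
      \<comment> \<open>Being the square of \<open>r^2 + t^2\<close>, this norm is 1 for either
        sign.\<close>
      have "(r\<^sup>2)\<^sup>2 + (- (r * t))\<^sup>2 + (t\<^sup>2)\<^sup>2 + (r * t)\<^sup>2 = (r\<^sup>2 + t\<^sup>2)\<^sup>2"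
        by (simp add: power2_eq_square algebra_simps)
      also have "\<dots> = 1" using rt by auto
      finally show ?thesis
        unfolding w' by (intro units_in_quat_over)
          (use r_in t_in closed in \<open>auto simp: Quat_in_quat_over_iff\<close>)
    qed
  qed
  ultimately have units: "{u, w} \<subseteq> units_in (quat_over (adjoin_int \<tau>))" by simp
  then obtain u' w' where inv: "u' * u = 1" "w' * w = 1" by (auto simp: units_in_def)

  have free: "u \<noteq> w \<and> free_semigroup_on {u, w} (semigroup_gen {u, w})"
    using N
  proof
    assume N1: "X\<^sup>2 - D = 1"
    then have "(real_of_int X)\<^sup>2 - s\<^sup>2 = 1" unfolding s2 by (metis of_int_1 of_int_diff of_int_power)
    \<comment> \<open>For \<open>X = 1\<close> the equation would force \<open>D = 0\<close>; this
      yields the bound \<open>x >= 2\<close> of the norm 1 lemmas.\<close>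
    moreover have "X \<noteq> 1" using N1 D0 by auto
    then have "real_of_int X \<ge> 2" using X1 by linarith
    ultimately show ?thesis
      using wX swap_shape_free_pos[OF t rX _ _ s0 assms(9) _ inv]
        half_shape_free_pos[OF t rX _ _ s0 assms(9) _ inv]
        square_shape_free_pos[OF t rX _ _ s0 assms(9) _ inv] by blast
  next
    assume N1: "X\<^sup>2 - D = - 1"
    then have "D = X\<^sup>2 + 1" by simp
    then have "s\<^sup>2 = (real_of_int X)\<^sup>2 + 1" unfolding s2 by simp
    moreover have "real_of_int X \<ge> 1" using X1 by simp
    moreover have "w = Quat t 0 0 r \<or> w = Quat (r\<^sup>2) (- (r * t)) (t\<^sup>2) (r * t)"
      using wX not_halved[OF N1] by (auto simp: halved_def)
    ultimately show ?thesis
      using swap_shape_free_neg[OF t rX _ _ s0 assms(9) _ inv]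
        square_shape_free_neg[OF t rX _ _ s0 assms(9) _ inv] by blast
  qed

  \<comment> \<open>Inverses found over the smaller ring remain inverses over
    \<open>O\<^sub>K\<close>, so an inclusion of coefficient rings transfers the unit
    statement.\<close>
  have "adjoin_int \<tau> \<subseteq> O\<^sub>K"
  proof
    fix a assume a: "a \<in> adjoin_int \<tau>"
    then obtain m n where "a = of_int m + of_int n * \<tau>" by (auto simp: adjoin_int_def)
    moreover have "\<tau> = of_rat (if halved then y / 2 else y) * csqrt (- of_int d)"
      using assms(8) by (simp add: \<tau>_def of_rat_divide)
    ultimately have "a = of_rat (of_int m) + of_rat (of_int n * (if halved then y / 2 else y)) * csqrt (- of_int d)"
      by (simp add: of_rat_mult)
    then have "a \<in> K" unfolding K_def quad_field_def by blast
    then show "a \<in> O\<^sub>K" using algebraic_int_adjoin_int[OF \<tau>2 a] by (simp add: O)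
  qed
  then have "units_in (quat_over (adjoin_int \<tau>)) \<subseteq> units_in (quat_over O\<^sub>K)"
    unfolding units_in_def quat_over_def by blast
  moreover have "semigroup_gen {u, w} \<subseteq> units_in (quat_over (adjoin_int \<tau>))"
    by (intro semigroup_gen_subset units units_in_mult quat_over_adjoin_int_mult[OF \<tau>2])
  ultimately show ?thesis using free by blast
qed

end
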